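(* Let $d\geq 2$ and $n\geq 1$ be integers. If $M\subset[n]^d$ is a minimal non-basic subset such that every layer of $[n]^d$ has a non-empty intersection with $M$, then $$2n\leq |M|\leq dn-(d-2).$$
   Context: Notation: $[n]=\{1,\ldots,n\}$. A finite subset $M\subset\mathbb{R}^d$ (in particular, a subset $M\subset[n]^d$) is called basic if for any function $f\colon M\to\mathbb{R}$ there exist functions $f_1,\ldots,f_d\colon\mathbb{R}\to\mathbb{R}$ such that $f(x_1,\ldots,x_d)=f_1(x_1)+\ldots+f_d(x_d)$ for every $(x_1,\ldots,x_d)\in M$. A non-basic subset $M\subset[n]^d$ is called minimal if every proper subset $K\subsetneq M$ is basic. A layer of $[n]^d$ is a hyperplane given by an equation $x_i=j$ with $i\in[d]$, $j\in[n]$ (so there are $dn$ layers). *)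

theory Defs
  imports "HOL-Analysis.Analysis"
begin

text \<open>
  The dimension \<open>d\<close> is \<open>CARD('d)\<close>, and \<open>real ^ 'd\<close> is \<open>d\<close>-dimensional Euclidean space.
  The notion of a basic set is only meant for finite \<open>M\<close>. A function on \<open>M\<close> is represented
  by a total function of which only the values on \<open>M\<close> matter.
\<close>

definition basic :: "(real ^ 'd) set \<Rightarrow> bool" where
  "basic M \<longleftrightarrow> (\<forall>f :: real ^ 'd \<Rightarrow> real. \<exists>g :: 'd \<Rightarrow> real \<Rightarrow> real.
     \<forall>x\<in>M. f x = (\<Sum>i\<in>UNIV. g i (x $ i)))"

definition minimal_nonbasic :: "(real ^ 'd) set \<Rightarrow> bool" where
  "minimal_nonbasic M \<longleftrightarrow> \<not> basic M \<and> (\<forall>K. K \<subset> M \<longrightarrow> basic K)"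

definition grid :: "nat \<Rightarrow> (real ^ 'd) set" where
  "grid n = {x. \<forall>i. x $ i \<in> real ` {1..n}}"

text \<open>The layers of \<open>grid n\<close> are the hyperplanes \<open>layer i j\<close> with \<open>j \<in> {1..n}\<close>.\<close>

definition layer :: "'d \<Rightarrow> nat \<Rightarrow> (real ^ 'd) set" where
  "layer i j = {x. x $ i = real j}"

end

theory Submission
  imports Defs "HOL-Library.Function_Algebras"
begin

text \<open>
  Both bounds come from deleting one point \<open>p\<close> of \<open>M\<close>, after which \<open>M\<close> becomes basic.

  If \<open>p\<close> were the only point of \<open>M\<close> on some layer \<open>x\<^sub>i = j\<close>, a decomposition on \<open>M - {p}\<close> could be
  corrected at \<open>p\<close> by changing the single value \<open>g\<^sub>i(j)\<close>, and \<open>M\<close> would be basic. So every one of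
  the \<open>n\<close> parallel layers in a fixed direction contains at least two points
  (\<open>two_points_on_layer\<close>), and these layers partition \<open>M\<close>, which gives \<open>2n \<le> |M|\<close>.

  A subset \<open>K\<close> of the grid is basic exactly when the indicators of the layers span the \<open>|K|\<close>-dimensional space of
  functions on \<open>K\<close>. The \<open>n\<close> indicators in each of the \<open>d\<close> directions sum to the same constant
  function, so it and the layers with \<open>j \<ge> 2\<close> already span, whence \<open>|K| \<le> d(n - 1) + 1\<close>
  (\<open>card_basic_le\<close>). Taking \<open>K = M - {p}\<close> gives \<open>|M| \<le> dn - (d - 2)\<close>.
\<close>

text \<open>
  The dimension count is applied to functions on \<open>K\<close>. As these form no type of their own, they are
  extended by zero to the whole type and viewed in the space of all real functions there.
\<close>

interpretation fun_space: vector_space "\<lambda>(c::real) (f :: 'a \<Rightarrow> real) x. c * f x"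
  by unfold_locales (auto simp: fun_eq_iff algebra_simps)

lemma sum_fun_apply: "(\<Sum>i\<in>A. h i) x = (\<Sum>i\<in>A. h i x)" for h :: "'i \<Rightarrow> 'a \<Rightarrow> real"
  by (induction A rule: infinite_finite_induct) auto

lemma independent_point_indicators:
  "fun_space.independent ((\<lambda>p. indicator {p} :: 'a \<Rightarrow> real) ` K)"
proof
  let ?e = "\<lambda>p. indicator {p} :: 'a \<Rightarrow> real"
  assume "fun_space.dependent (?e ` K)"
  then obtain p where p: "?e p \<in> fun_space.span (?e ` K - {?e p})"
    unfolding fun_space.dependent_def by blast
  \<comment> \<open>All the other indicators vanish at \<open>p\<close>, hence so does their whole span.\<close>
  have "fun_space.subspace {f :: 'a \<Rightarrow> real. f p = 0}"
    by (rule fun_space.subspaceI) auto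
  moreover have "?e ` K - {?e p} \<subseteq> {f. f p = 0}"
    by (auto simp: indicator_def)
  ultimately have "?e p \<in> {f. f p = 0}"
    using p fun_space.span_minimal by blast
  then show False by simp
qed

lemma finite_grid: "finite (grid n :: (real ^ 'd) set)"
proof (rule finite_imageD)
  have "vec_nth ` (grid n :: (real ^ 'd) set) \<subseteq> (\<Pi>\<^sub>E i\<in>UNIV. real ` {1..n})"
    by (auto simp: grid_def PiE_def)
  then show "finite (vec_nth ` (grid n :: (real ^ 'd) set))"
    by (rule finite_subset) (intro finite_PiE finite_imageI finite_atLeastAtMost finite)
qed (auto intro!: inj_onI simp: vec_eq_iff)

text \<open>
  A decomposition on \<open>M - {p}\<close>, where \<open>p\<close> is the only point of \<open>M\<close> on the layer, extends to \<open>M\<close>: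
  the value \<open>g i j\<close> enters the sum only at \<open>p\<close>, so adjusting it by the error at \<open>p\<close> changes
  nothing elsewhere.
\<close>

lemma two_points_on_layer:
  fixes M :: "(real ^ 'd) set"
  assumes "minimal_nonbasic M" "finite M" "layer i j \<inter> M \<noteq> {}"
  shows "2 \<le> card (layer i j \<inter> M)"
proof (rule ccontr)
  assume "\<not> 2 \<le> card (layer i j \<inter> M)"
  moreover have "card (layer i j \<inter> M) \<noteq> 0"
    using assms by simp
  ultimately have "card (layer i j \<inter> M) = 1"
    by linarith
  then obtain p where p: "layer i j \<inter> M = {p}"
    by (auto simp: card_1_singleton_iff)
  then have pM: "p \<in> M" and pj: "p $ i = real j"
    by (auto simp: layer_def)
  have other: "x $ i \<noteq> real j" if "x \<in> M - {p}" for x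
    using p that by (auto simp: layer_def)
  have "M - {p} \<subset> M" using pM by blast
  then have "basic (M - {p})"
    using assms(1) by (simp add: minimal_nonbasic_def)
  have "basic M"
    unfolding basic_def
  proof
    fix f :: "real ^ 'd \<Rightarrow> real"
    obtain g where g: "f x = (\<Sum>k\<in>UNIV. g k (x $ k))" if "x \<in> M - {p}" for x
      using \<open>basic (M - {p})\<close> unfolding basic_def by metis
    define e where "e = f p - (\<Sum>k\<in>UNIV. g k (p $ k))"
    define g' where "g' k t = g k t + (if k = i \<and> t = real j then e else 0)" for k t
    have g': "(\<Sum>k\<in>UNIV. g' k (x $ k)) = (\<Sum>k\<in>UNIV. g k (x $ k)) + (if x $ i = real j then e else 0)" for x
    proof -
      have "(\<Sum>k\<in>UNIV. if k = i \<and> x $ k = real j then e else 0)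
          = (\<Sum>k\<in>UNIV. if k = i then (if x $ i = real j then e else 0) else 0)"
        by (rule sum.cong) auto
      then show ?thesis
        by (simp add: g'_def sum.distrib)
    qed
    have "f x = (\<Sum>k\<in>UNIV. g' k (x $ k))" if "x \<in> M" for x
      using that g[of x] other[of x] pj unfolding g' by (cases "x = p") (auto simp: e_def)
    then show "\<exists>g. \<forall>x\<in>M. f x = (\<Sum>k\<in>UNIV. g k (x $ k))"
      by blast
  qed
  then show False
    using assms(1) by (simp add: minimal_nonbasic_def)
qed

text \<open>
  The point indicators of \<open>K\<close> are independent and lie in the span of \<open>T\<close>, the constant function and
  the layers other than the first in each direction; so \<open>T\<close> has at least \<open>card K\<close> elements.
\<close>

lemma card_basic_le:
  fixes K :: "(real ^ 'd) set"
  assumes "basic K" "K \<subseteq> grid n"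
  shows "card K \<le> CARD('d) * (n - 1) + 1"
proof -
  define u :: "real ^ 'd \<Rightarrow> real" where "u = indicator K"
  define \<phi> :: "'d \<times> nat \<Rightarrow> real ^ 'd \<Rightarrow> real"
    where "\<phi> = (\<lambda>(i, j). indicator (layer i j \<inter> K))"
  define T where "T = insert u (\<phi> ` (UNIV \<times> {2..n}))"
  let ?e = "\<lambda>p. indicator {p} :: real ^ 'd \<Rightarrow> real"
  have "?e p \<in> fun_space.span T" if "p \<in> K" for p
  proof -
    obtain g where g: "?e p x = (\<Sum>i\<in>UNIV. g i (x $ i))" if "x \<in> K" for x
      using \<open>basic K\<close> unfolding basic_def by metis
    \<comment> \<open>Replacing each \<open>g i\<close> by \<open>g i - g i 1\<close> makes the coefficient of every first layer vanish, at the
      cost of a constant.\<close>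
    have *: "?e p = (\<lambda>x. (\<Sum>i\<in>UNIV. g i 1) * u x) +
        (\<Sum>i\<in>UNIV. \<Sum>j\<in>{2..n}. (\<lambda>x. (g i (real j) - g i 1) * \<phi> (i, j) x))"
    proof
      fix x
      show "?e p x = ((\<lambda>x. (\<Sum>i\<in>UNIV. g i 1) * u x) +
        (\<Sum>i\<in>UNIV. \<Sum>j\<in>{2..n}. (\<lambda>x. (g i (real j) - g i 1) * \<phi> (i, j) x))) x"
      proof (cases "x \<in> K")
        case True
        have "(\<Sum>j\<in>{2..n}. (g i (real j) - g i 1) * \<phi> (i, j) x) = g i (x $ i) - g i 1" for i
        proof -
          obtain k where k: "x $ i = real k" "k \<in> {1..n}"
            using True \<open>K \<subseteq> grid n\<close> by (force simp: grid_def)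
          have "(\<Sum>j\<in>{2..n}. (g i (real j) - g i 1) * \<phi> (i, j) x)
              = (\<Sum>j\<in>{2..n}. if j = k then g i (real k) - g i 1 else 0)"
            using True k by (intro sum.cong) (auto simp: \<phi>_def layer_def)
          also have "\<dots> = g i (x $ i) - g i 1"
            using k by (cases "k = 1") auto
          finally show ?thesis .
        qed
        then show ?thesis
          using True g[OF True] by (simp add: sum_fun_apply u_def sum_subtractf)
      next
        case False
        then have "x \<noteq> p" using \<open>p \<in> K\<close> by blast
        then show ?thesis
          using False by (simp add: sum_fun_apply u_def \<phi>_def)
      qed
    qed
    show ?thesis
      unfolding *
      by (intro fun_space.span_add fun_space.span_sum fun_space.span_scale fun_space.span_base)
        (auto simp: T_def)
  qed
  then have "?e ` K \<subseteq> fun_space.span T" by blast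
  moreover have "finite T" by (simp add: T_def)
  ultimately have "card (?e ` K) \<le> card T"
    using fun_space.independent_span_bound independent_point_indicators by blast
  moreover have "card (?e ` K) = card K"
  proof (intro card_image inj_onI)
    fix x y assume "?e x = ?e y"
    from fun_cong[OF this, of x] show "x = y" by (simp add: indicator_eq_1_iff)
  qed
  moreover have "card T \<le> Suc (card (\<phi> ` (UNIV \<times> {2..n})))"
    unfolding T_def by (rule card_insert_le_m1) auto
  moreover have "card (\<phi> ` (UNIV \<times> {2..n})) \<le> card ((UNIV :: 'd set) \<times> {2..n})"
    by (rule card_image_le) simp
  moreover have "card ((UNIV :: 'd set) \<times> {2..n}) = CARD('d) * (n - 1)"
    by (simp add: card_cartesian_product)
  ultimately show ?thesis by linarith
qed

theorem theorem1p2: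
  fixes M :: "(real ^ 'd) set" and n :: nat
  assumes "CARD('d) \<ge> 2" and "n \<ge> 1"
    and "M \<subseteq> grid n"
    and "minimal_nonbasic M"
    and "\<And>i j. j \<in> {1..n} \<Longrightarrow> layer i j \<inter> M \<noteq> {}"
  shows "2 * n \<le> card M \<and>
         int (card M) \<le> int CARD('d) * int n - (int CARD('d) - 2)"
proof
  have fin: "finite M"
    using assms(3) finite_grid finite_subset by blast
  fix i :: 'd
  have "2 * n = (\<Sum>j\<in>{1..n}. 2)" by simp
  also have "\<dots> \<le> (\<Sum>j\<in>{1..n}. card (layer i j \<inter> M))"
    using assms(4,5) fin by (intro sum_mono two_points_on_layer) auto
  also have "\<dots> = card (\<Union>j\<in>{1..n}. layer i j \<inter> M)"
    using fin by (intro card_UN_disjoint[symmetric]) (auto simp: layer_def)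
  also have "(\<Union>j\<in>{1..n}. layer i j \<inter> M) = M"
    using assms(3) by (force simp: layer_def grid_def)
  finally show "2 * n \<le> card M" .

  have "M \<noteq> {}"
    using assms(2,5) by fastforce
  then obtain p where "p \<in> M" by blast
  then have "basic (M - {p})"
    using assms(4) by (auto simp: minimal_nonbasic_def)
  then have "card (M - {p}) \<le> CARD('d) * (n - 1) + 1"
    using assms(3) by (intro card_basic_le) auto
  then have "card M \<le> CARD('d) * (n - 1) + 2"
    using \<open>p \<in> M\<close> fin by (simp add: card_Diff_singleton)
  then have "int (card M) \<le> int (CARD('d) * (n - 1) + 2)"
    by (simp only: of_nat_le_iff)
  also have "\<dots> = int CARD('d) * int n - (int CARD('d) - 2)"
    using assms(2) by (simp add: of_nat_diff algebra_simps)
  finally show "int (card M) \<le> int CARD('d) * int n - (int CARD('d) - 2)" .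
qed

end
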